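(* Assume (A0'), (A1) and (A2), and let $(v^k)$, $(\varphi^k)$ be the sequences generated by the iterative algorithm. If the sequences $\big(\mathbb A^{-1}\mathbb B(\varphi^k,\varphi^{k+1})\big)_k$ and $\big(\mathbb A^{-1}\mathbb C(\varphi^k,\varphi^{k+1})\big)_k$ converge, then $(v^k)$ converges.
   Context: Grid and operators. $G$ is a symmetric grid $x_{-N}=-x_N<\dots<x_{-1}=-x_1<x_0=0<x_1<\dots<x_N$ of real numbers; $\mathbb R^G$ is the set of functions $G\to\mathbb R$ (vectors), linear operators on $\mathbb R^G$ are identified with matrices in $\mathbb R^{G\times G}$, and orders, max, argmax are pointwise (elementwise). $S$ is the symmetry operator $Sv(x)=v(-x)$. $G_{<0}$ is the set of negative grid points; complements are taken in $G$. $f\in\mathbb R^G$ and $L:\mathbb R^G\to\mathbb R^G$ is linear. For each $x\in G$, $Z(x)\subseteq\mathbb R$ is a finite nonempty set, with $Z(x)=\{0\}$ if $x\ge0$; $Z=\prod_{x\in G}Z(x)$. For each $\delta\in Z$ there are given a linear $B(\delta):\mathbb R^G\to\mathbb R^G$, $c(\delta)\in(0,+\infty)^G$ and a vector $g(S\delta)\in\mathbb R^G$; these are row-decoupled: row $x$ of $B(\delta)$ and $c(\delta)$ depends only on $\delta(x)$, and entry $x$ of $g(S\delta)$ depends only on $(S\delta)(x)=\delta(-x)$. For $x\ge 0$ row $x$ of $B(\delta)$ is row $x$ of the identity. Define $Mv=\max_{\delta\in Z}\{B(\delta)v-c(\delta)\}$, $\delta^*(v)=\max(\operatorname{argmax}_{\delta\in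 Z}\{B(\delta)v-c(\delta)\})$ (pointwise largest maximizer) and $H(\delta)v=SB(\delta)Sv+g(S\delta)$. Strategies. $\Phi=\{\varphi=(I,\delta): I\subseteq G_{<0},\ \delta\in Z\}$. Each $I\subseteq G_{<0}$ is identified with its indicator $\psi=\mathbf 1_I$, and $\psi$ with the diagonal matrix $\Psi=\operatorname{diag}(\psi)$ (likewise $\overline I,\overline\psi,\overline\Psi$). Algorithm (run indefinitely, with the single-player problems solved exactly). Choose $v^0\in\mathbb R^G$, set $I^0=\{Lv^0+f\le Mv^0-v^0\}\cap G_{<0}$ and $\delta^0=\delta^*(v^0)$. For $k=0,1,\dots$: let $v^{k+1/2}=H(\delta^k)v^k$ on $-I^k$ and $v^{k+1/2}=v^k$ on $(-I^k)^c$; with $D=(-I^k)^c$, let $v^{k+1}\in\mathbb R^G$ be the (unique) solution of $\max\{Lv+f,Mv-v\}=0$ on $D$ subject to $v=v^{k+1/2}$ on $D^c$; set $I^{k+1}=\{x\in D: (Lv^{k+1}+f)(x)\le\lambda(Mv^{k+1}-v^{k+1})(x)\}$ (a subset of $G_{<0}$), where $\lambda>0$ is a fixed scaling factor, and $\delta^{k+1}=\delta^*(v^{k+1})$. $\varphi^k=(\psi^k,\delta^k)$ with $\psi^k=\mathbf 1_{I^k}$. Coefficients. For $\varphi=(\psi,\delta),\overline\varphi=(\overline\psi,\overline\delta)\in\Phi$: $\mathbb A(\varphi,\overline\varphi)=\operatorname{Id}-(\operatorname{Id}-\overline\Psi-S\Psi S)(\operatorname{Id}+L)-\overline\Psi B(\overline\delta)$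 (nonsingular under the assumptions), $\mathbb B(\varphi)=S\Psi B(\delta)S$, $\mathbb C(\varphi,\overline\varphi)=(\operatorname{Id}-\overline\Psi-S\Psi S)f-\overline\Psi c(\overline\delta)+S\Psi S\,g(S\delta)$; $\mathbb A^{-1}\mathbb B(\varphi,\overline\varphi)=\mathbb A(\varphi,\overline\varphi)^{-1}\mathbb B(\varphi)$, $\mathbb A^{-1}\mathbb C(\varphi,\overline\varphi)=\mathbb A(\varphi,\overline\varphi)^{-1}\mathbb C(\varphi,\overline\varphi)$. Matrix notions. For a real square matrix $A$: row $i$ is WDD (resp. SDD) if $|A_{ii}|\ge\sum_{j\ne i}|A_{ij}|$ (resp. $>$); $A$ is WDD (SDD) if all rows are; $A$ is an $L_0$-matrix if its off-diagonal entries are $\le0$ and its diagonal entries are $\ge0$. graph$A$ is the directed graph on the row indices with an edge $(i,j)$ iff $A_{ij}\neq0$; a walk is a nonempty finite sequence of consecutive edges. Assumptions. (A0') For each pair of strategies $\varphi=(I,\delta),\overline\varphi=(\overline I,\overline\delta)\in\Phi$ and each $x\in\overline I\cup(-I)$, there is a walk in graph$\big(\overline\Psi B(\overline\delta)+S\Psi B(\delta)S\big)$ from row $x$ to some row $y\in\overline I^c\cap(-I)^c$ (the common continuation region). (A1) $-L$ is an SDD $L_0$-matrix and, for each $\delta\in Z$, $\operatorname{Id}-B(\delta)$ is a WDD $L_0$-matrix. (A2) $B(\delta)$ has nonnegative diagonal elements for all $\delta\in Z$. *)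

theory Defs
  imports "HOL-Analysis.Analysis"
begin

section \<open>Symmetric grids\<close>

text \<open>
  A grid is given by a finite index type together with the real coordinate of each node, so that
  functions on the grid are vectors \<open>real ^ 'g\<close> and linear operators are matrices
  \<open>real ^ 'g ^ 'g\<close>. The numbers \<open>- x\<^sub>N < \<dots> < 0 < \<dots> < x\<^sub>N\<close> are the elements of \<open>range pt\<close>;
  listing them in increasing order carries no further information.
\<close>

definition sym_grid :: "('g::finite \<Rightarrow> real) \<Rightarrow> bool" where
  "sym_grid pt \<longleftrightarrow> inj pt \<and> 0 \<in> range pt \<and> (\<forall>x. - pt x \<in> range pt)"

text \<open>\<open>mirror pt x\<close> is the grid node \<open>- x\<close>; the set \<open>- I\<close> is \<open>mirror pt ` I\<close>.\<close>

definition mirror :: "('g::finite \<Rightarrow> real) \<Rightarrow> 'g \<Rightarrow> 'g" where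
  "mirror pt x = (THE y. pt y = - pt x)"

lemma pt_mirror:
  assumes "sym_grid pt"
  shows "pt (mirror pt x) = - pt x"
proof -
  from assms obtain y where y: "pt y = - pt x"
    unfolding sym_grid_def by (metis rangeE)
  have "z = y" if "pt z = - pt x" for z
    using assms y that unfolding sym_grid_def by (metis injD)
  with y show ?thesis
    unfolding mirror_def by (rule theI)
qed

definition grid_neg :: "('g::finite \<Rightarrow> real) \<Rightarrow> 'g set" where
  "grid_neg pt = {x. pt x < 0}"

definition symm :: "('g::finite \<Rightarrow> real) \<Rightarrow> real ^ 'g \<Rightarrow> real ^ 'g" where
  "symm pt v = (\<chi> x. v $ mirror pt x)"

definition symm_mat :: "('g::finite \<Rightarrow> real) \<Rightarrow> real ^ 'g ^ 'g" where
  "symm_mat pt = matrix (symm pt)"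

section \<open>Matrix notions\<close>

definition wdd_row :: "real ^ 'g ^ 'g \<Rightarrow> 'g::finite \<Rightarrow> bool" where
  "wdd_row A i \<longleftrightarrow> \<bar>A $ i $ i\<bar> \<ge> (\<Sum>j\<in>UNIV - {i}. \<bar>A $ i $ j\<bar>)"

definition sdd_row :: "real ^ 'g ^ 'g \<Rightarrow> 'g::finite \<Rightarrow> bool" where
  "sdd_row A i \<longleftrightarrow> \<bar>A $ i $ i\<bar> > (\<Sum>j\<in>UNIV - {i}. \<bar>A $ i $ j\<bar>)"

definition wdd :: "real ^ 'g ^ 'g::finite \<Rightarrow> bool" where
  "wdd A \<longleftrightarrow> (\<forall>i. wdd_row A i)"

definition sdd :: "real ^ 'g ^ 'g::finite \<Rightarrow> bool" where
  "sdd A \<longleftrightarrow> (\<forall>i. sdd_row A i)"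

definition L0_matrix :: "real ^ 'g ^ 'g::finite \<Rightarrow> bool" where
  "L0_matrix A \<longleftrightarrow> (\<forall>i j. i \<noteq> j \<longrightarrow> A $ i $ j \<le> 0) \<and> (\<forall>i. A $ i $ i \<ge> 0)"

text \<open>
  The edge relation of the graph of a matrix. Walks consist of at least one edge, so \<open>y\<close> is
  reachable from \<open>x\<close> by a walk iff \<open>(x, y) \<in> (matrix_graph A)\<^sup>+\<close>.
\<close>

definition matrix_graph :: "real ^ 'g ^ 'g::finite \<Rightarrow> ('g \<times> 'g) set" where
  "matrix_graph A = {(i, j). A $ i $ j \<noteq> 0}"

definition diag_ind :: "'g::finite set \<Rightarrow> real ^ 'g ^ 'g" where
  "diag_ind I = (\<chi> i j. if i = j then indicator I i else 0)"

section \<open>Impulse controls and operators\<close>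

definition controls :: "('g::finite \<Rightarrow> real set) \<Rightarrow> (real ^ 'g) set" where
  "controls Z = {\<delta>. \<forall>x. \<delta> $ x \<in> Z x}"

definition gain_op ::
  "('g::finite \<Rightarrow> real set) \<Rightarrow> (real ^ 'g \<Rightarrow> real ^ 'g ^ 'g) \<Rightarrow> (real ^ 'g \<Rightarrow> real ^ 'g)
    \<Rightarrow> real ^ 'g \<Rightarrow> real ^ 'g" where
  "gain_op Z B c v = (\<chi> x. Max ((\<lambda>\<delta>. (B \<delta> *v v - c \<delta>) $ x) ` controls Z))"

definition maximizers ::
  "('g::finite \<Rightarrow> real set) \<Rightarrow> (real ^ 'g \<Rightarrow> real ^ 'g ^ 'g) \<Rightarrow> (real ^ 'g \<Rightarrow> real ^ 'g)
    \<Rightarrow> real ^ 'g \<Rightarrow> (real ^ 'g) set" where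
  "maximizers Z B c v = {\<delta> \<in> controls Z. B \<delta> *v v - c \<delta> = gain_op Z B c v}"

definition opt_control ::
  "('g::finite \<Rightarrow> real set) \<Rightarrow> (real ^ 'g \<Rightarrow> real ^ 'g ^ 'g) \<Rightarrow> (real ^ 'g \<Rightarrow> real ^ 'g)
    \<Rightarrow> real ^ 'g \<Rightarrow> real ^ 'g" where
  "opt_control Z B c v = (\<chi> x. Max ((\<lambda>\<delta>. \<delta> $ x) ` maximizers Z B c v))"

text \<open>The argument of \<open>g\<close> is the reflected control \<open>S \<delta>\<close>.\<close>

definition opponent_op ::
  "('g::finite \<Rightarrow> real) \<Rightarrow> (real ^ 'g \<Rightarrow> real ^ 'g ^ 'g) \<Rightarrow> (real ^ 'g \<Rightarrow> real ^ 'g)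
    \<Rightarrow> real ^ 'g \<Rightarrow> real ^ 'g \<Rightarrow> real ^ 'g" where
  "opponent_op pt B g \<delta> v = symm pt (B \<delta> *v symm pt v) + g (symm pt \<delta>)"

definition row_decoupled ::
  "('g::finite \<Rightarrow> real) \<Rightarrow> ('g \<Rightarrow> real set) \<Rightarrow> (real ^ 'g \<Rightarrow> real ^ 'g ^ 'g)
    \<Rightarrow> (real ^ 'g \<Rightarrow> real ^ 'g) \<Rightarrow> (real ^ 'g \<Rightarrow> real ^ 'g) \<Rightarrow> bool" where
  "row_decoupled pt Z B c g \<longleftrightarrow>
    (\<forall>\<delta>\<in>controls Z. \<forall>\<delta>'\<in>controls Z. \<forall>x.
      (\<delta> $ x = \<delta>' $ x \<longrightarrow> row x (B \<delta>) = row x (B \<delta>') \<and> c \<delta> $ x = c \<delta>' $ x) \<and>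
      (symm pt \<delta> $ x = symm pt \<delta>' $ x \<longrightarrow> g (symm pt \<delta>) $ x = g (symm pt \<delta>') $ x))"

section \<open>Strategies and coefficients\<close>

definition strategies ::
  "('g::finite \<Rightarrow> real) \<Rightarrow> ('g \<Rightarrow> real set) \<Rightarrow> ('g set \<times> (real ^ 'g)) set" where
  "strategies pt Z = {(I, \<delta>). I \<subseteq> grid_neg pt \<and> \<delta> \<in> controls Z}"

fun coeff_A ::
  "('g::finite \<Rightarrow> real) \<Rightarrow> real ^ 'g ^ 'g \<Rightarrow> (real ^ 'g \<Rightarrow> real ^ 'g ^ 'g)
    \<Rightarrow> 'g set \<times> (real ^ 'g) \<Rightarrow> 'g set \<times> (real ^ 'g) \<Rightarrow> real ^ 'g ^ 'g" where
  "coeff_A pt L B (I, \<delta>) (I', \<delta>') =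
    mat 1 - (mat 1 - diag_ind I' - symm_mat pt ** diag_ind I ** symm_mat pt) ** (mat 1 + L)
      - diag_ind I' ** B \<delta>'"

fun coeff_B ::
  "('g::finite \<Rightarrow> real) \<Rightarrow> (real ^ 'g \<Rightarrow> real ^ 'g ^ 'g)
    \<Rightarrow> 'g set \<times> (real ^ 'g) \<Rightarrow> real ^ 'g ^ 'g" where
  "coeff_B pt B (I, \<delta>) = symm_mat pt ** diag_ind I ** B \<delta> ** symm_mat pt"

fun coeff_C ::
  "('g::finite \<Rightarrow> real) \<Rightarrow> real ^ 'g \<Rightarrow> (real ^ 'g \<Rightarrow> real ^ 'g) \<Rightarrow> (real ^ 'g \<Rightarrow> real ^ 'g)
    \<Rightarrow> 'g set \<times> (real ^ 'g) \<Rightarrow> 'g set \<times> (real ^ 'g) \<Rightarrow> real ^ 'g" where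
  "coeff_C pt f c g (I, \<delta>) (I', \<delta>') =
    (mat 1 - diag_ind I' - symm_mat pt ** diag_ind I ** symm_mat pt) *v f
      - diag_ind I' *v c \<delta>'
      + (symm_mat pt ** diag_ind I ** symm_mat pt) *v g (symm pt \<delta>)"

definition inv_A_B ::
  "('g::finite \<Rightarrow> real) \<Rightarrow> real ^ 'g ^ 'g \<Rightarrow> (real ^ 'g \<Rightarrow> real ^ 'g ^ 'g)
    \<Rightarrow> 'g set \<times> (real ^ 'g) \<Rightarrow> 'g set \<times> (real ^ 'g) \<Rightarrow> real ^ 'g ^ 'g" where
  "inv_A_B pt L B \<phi> \<phi>' = matrix_inv (coeff_A pt L B \<phi> \<phi>') ** coeff_B pt B \<phi>"

definition inv_A_C ::
  "('g::finite \<Rightarrow> real) \<Rightarrow> real ^ 'g ^ 'g \<Rightarrow> real ^ 'g \<Rightarrow> (real ^ 'g \<Rightarrow> real ^ 'g ^ 'g)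
    \<Rightarrow> (real ^ 'g \<Rightarrow> real ^ 'g) \<Rightarrow> (real ^ 'g \<Rightarrow> real ^ 'g)
    \<Rightarrow> 'g set \<times> (real ^ 'g) \<Rightarrow> 'g set \<times> (real ^ 'g) \<Rightarrow> real ^ 'g" where
  "inv_A_C pt L f B c g \<phi> \<phi>' = matrix_inv (coeff_A pt L B \<phi> \<phi>') *v coeff_C pt f c g \<phi> \<phi>'"

section \<open>The iterative algorithm\<close>

definition half_step ::
  "('g::finite \<Rightarrow> real) \<Rightarrow> (real ^ 'g \<Rightarrow> real ^ 'g ^ 'g) \<Rightarrow> (real ^ 'g \<Rightarrow> real ^ 'g)
    \<Rightarrow> 'g set \<times> (real ^ 'g) \<Rightarrow> real ^ 'g \<Rightarrow> real ^ 'g" where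
  "half_step pt B g \<phi> v =
    (\<chi> x. if x \<in> mirror pt ` fst \<phi> then opponent_op pt B g (snd \<phi>) v $ x else v $ x)"

definition solves_qvi ::
  "real ^ 'g ^ 'g \<Rightarrow> real ^ 'g \<Rightarrow> ('g::finite \<Rightarrow> real set) \<Rightarrow> (real ^ 'g \<Rightarrow> real ^ 'g ^ 'g)
    \<Rightarrow> (real ^ 'g \<Rightarrow> real ^ 'g) \<Rightarrow> 'g set \<Rightarrow> real ^ 'g \<Rightarrow> real ^ 'g \<Rightarrow> bool" where
  "solves_qvi L f Z B c D w u \<longleftrightarrow>
    (\<forall>x\<in>D. max ((L *v u + f) $ x) ((gain_op Z B c u - u) $ x) = 0) \<and>
    (\<forall>x\<in>-D. u $ x = w $ x)"

text \<open>
  \<open>v\<close> and \<open>\<phi>\<close> are the iterates and strategies of a run that never stops. Each new iterate is only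
  required to be a solution of the single-player problem; that it is the only one follows from the
  standing assumptions and is not a hypothesis here.
\<close>

definition generated_by_algorithm ::
  "('g::finite \<Rightarrow> real) \<Rightarrow> real ^ 'g ^ 'g \<Rightarrow> real ^ 'g \<Rightarrow> ('g \<Rightarrow> real set)
    \<Rightarrow> (real ^ 'g \<Rightarrow> real ^ 'g ^ 'g) \<Rightarrow> (real ^ 'g \<Rightarrow> real ^ 'g) \<Rightarrow> (real ^ 'g \<Rightarrow> real ^ 'g)
    \<Rightarrow> real \<Rightarrow> (nat \<Rightarrow> real ^ 'g) \<Rightarrow> (nat \<Rightarrow> 'g set \<times> (real ^ 'g)) \<Rightarrow> bool" where
  "generated_by_algorithm pt L f Z B c g lam v \<phi> \<longleftrightarrow>
    fst (\<phi> 0) = {x. (L *v v 0 + f) $ x \<le> (gain_op Z B c (v 0) - v 0) $ x} \<inter> grid_neg pt \<and>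
    snd (\<phi> 0) = opt_control Z B c (v 0) \<and>
    (\<forall>k. let D = - (mirror pt ` fst (\<phi> k)) in
      solves_qvi L f Z B c D (half_step pt B g (\<phi> k) (v k)) (v (Suc k)) \<and>
      fst (\<phi> (Suc k)) =
        {x \<in> D. (L *v v (Suc k) + f) $ x
                  \<le> lam * (gain_op Z B c (v (Suc k)) - v (Suc k)) $ x} \<and>
      snd (\<phi> (Suc k)) = opt_control Z B c (v (Suc k)))"

end

theory Submission
  imports Defs
begin

text \<open>
  Each iteration solves a linear system. On the new impulse region \<open>I(k+1)\<close> the single-player
  problem gives \<open>v = B(\<delta>) v - c(\<delta>)\<close> with the maximizing control \<open>\<delta> = \<delta>(k+1)\<close>, on the opponent's region
  \<open>- I(k)\<close> the value is prescribed by \<open>H\<close>, and on the remaining nodes \<open>L v + f = 0\<close>. Together these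
  rows say \<open>A v(k+1) = N v(k) + C\<close> with the coefficients \<open>A\<close>, \<open>N\<close>, \<open>C\<close> of the pair
  \<open>(\<phi>(k), \<phi>(k+1))\<close>, where \<open>N\<close> stands for \<open>coeff_B\<close> (lemma \<open>iterate_linear_system\<close>).

  Controls and regions range over finite sets, so the convergent sequences \<open>A\<^sup>-\<^sup>1 N\<close> and \<open>A\<^sup>-\<^sup>1 C\<close>
  are eventually constant, and the tail of the run is a stationary affine iteration with the matrix
  \<open>M = A\<^sup>-\<^sup>1 N\<close> of one fixed pair of strategies. It remains to see that the powers of \<open>M\<close> tend to
  zero. Both \<open>A\<close> and \<open>A - N\<close> have nonpositive off-diagonal entries and nonnegative row sums, and the
  walks provided by (A0') lead from every row to one with positive row sum. Such matrices satisfy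
  a discrete maximum principle, \<open>W u \<ge> 0 \<Longrightarrow> u \<ge> 0\<close> (lemma \<open>weakly_chained_monotone\<close>), hence are invertible.
  With \<open>N \<ge> 0\<close> it follows that \<open>M \<ge> 0\<close> and \<open>M 1 \<le> 1\<close>, and that \<open>M\<close> fixes no nonzero vector, since
  \<open>M u = u\<close> means \<open>(A - N) u = 0\<close>.

  These three properties suffice, without any spectral theory: the vectors \<open>M\<^sup>n 1\<close> are nonnegative and
  decrease, so they converge; the limit is fixed by \<open>M\<close> and is therefore \<open>0\<close>; and \<open>M\<^sup>n u\<close> is dominated
  by a multiple of \<open>M\<^sup>n 1\<close> (lemma \<open>substochastic_powers_tendsto_zero\<close>).
\<close>

section \<open>Weakly chained diagonally dominant matrices\<close>

text \<open>
  A discrete maximum principle. In a row where \<open>u\<close> attains a negative minimum, the sign conditions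
  force the row sum to vanish and \<open>u\<close> to attain the minimum at every neighbour as well. Following
  the edges of \<open>R\<close>, the minimum spreads to a row with positive row sum, which is impossible. The
  product \<open>W *v 1\<close> is the vector of row sums. Edges of \<open>R\<close> have to be edges of \<open>W\<close> only when they leave
  a row with zero sum, so that one relation serves both \<open>A\<close> and \<open>A - N\<close>, which have different
  graphs.
\<close>

lemma weakly_chained_monotone:
  fixes W :: "real ^ 'n ^ 'n::finite"
  assumes off_diag: "\<And>i j. i \<noteq> j \<Longrightarrow> W $ i $ j \<le> 0"
    and row_sum: "\<And>i. 0 \<le> (W *v 1) $ i"
    and edge: "\<And>i j. (i, j) \<in> R \<Longrightarrow> (W *v 1) $ i = 0 \<Longrightarrow> i = j \<or> W $ i $ j \<noteq> 0"
    and chain: "\<And>i. \<exists>j. (i, j) \<in> R\<^sup>* \<and> 0 < (W *v 1) $ j"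
    and nonneg: "\<And>i. 0 \<le> (W *v u) $ i"
  shows "0 \<le> u $ i"
proof (rule ccontr)
  assume neg: "\<not> 0 \<le> u $ i"
  define m where "m = Min (range (\<lambda>j. u $ j))"
  have m_le: "m \<le> u $ j" for j
    unfolding m_def by (rule Min_le) auto
  have "m \<in> range (\<lambda>j. u $ j)"
    unfolding m_def by (rule Min_in) auto
  then obtain i0 where i0: "u $ i0 = m" by auto
  have m_neg: "m < 0" using m_le[of i] neg by simp
  \<comment> \<open>Splitting \<open>u = (u - m) + m\<close>, row \<open>p\<close> of \<open>W u\<close> is a sum of nonpositive terms, yet it is \<open>\<ge> 0\<close>.\<close>
  have at_min: "(W *v 1) $ p = 0 \<and> (\<forall>q. W $ p $ q * (u $ q - m) = 0)" if p: "u $ p = m" for p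
  proof -
    have term_le: "W $ p $ q * (u $ q - m) \<le> 0" for q
      using off_diag[of p q] m_le[of q] p by (cases "p = q") (auto intro: mult_nonpos_nonneg)
    have sum_le: "(\<Sum>q\<in>UNIV. W $ p $ q * (u $ q - m)) \<le> 0"
      by (rule sum_nonpos) (rule term_le)
    have split: "(W *v u) $ p = (\<Sum>q\<in>UNIV. W $ p $ q * (u $ q - m)) + m * (W *v 1) $ p"
      by (simp add: matrix_vector_mult_def sum_distrib_left algebra_simps flip: sum.distrib)
    have "m * (W *v 1) $ p \<le> 0"
      using m_neg row_sum[of p] by (simp add: mult_nonpos_nonneg)
    with split sum_le nonneg[of p]
    have eqs: "m * (W *v 1) $ p = 0" "(\<Sum>q\<in>UNIV. W $ p $ q * (u $ q - m)) = 0"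
      by linarith+
    have "W $ p $ q * (u $ q - m) = 0" for q
    proof (rule antisym[OF term_le])
      have "(\<Sum>q'\<in>UNIV. W $ p $ q' * (u $ q' - m)) \<le> W $ p $ q * (u $ q - m)"
        using sum_nonpos[of "UNIV - {q}" "\<lambda>q. W $ p $ q * (u $ q - m)"] term_le
        by (simp add: sum.remove[of UNIV q])
      then show "0 \<le> W $ p $ q * (u $ q - m)" using eqs(2) by simp
    qed
    with eqs(1) m_neg show ?thesis by auto
  qed
  obtain j where j: "(i0, j) \<in> R\<^sup>*" "0 < (W *v 1) $ j" using chain by blast
  from j(1) have "u $ j = m"
  proof (induction rule: rtrancl_induct)
    case (step y z)
    from at_min[OF step.IH] have "(W *v 1) $ y = 0" "W $ y $ z * (u $ z - m) = 0" by auto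
    with edge[OF step.hyps(2)] step.IH show ?case by (metis diff_eq_diff_eq diff_self mult_eq_0_iff)
  qed (rule i0)
  with at_min[of j] j(2) show False by simp
qed

lemma monotone_matrix_invertible:
  fixes W :: "real ^ 'n ^ 'n::finite"
  assumes mono: "\<And>u i. (\<And>j. 0 \<le> (W *v u) $ j) \<Longrightarrow> 0 \<le> u $ i"
  shows "invertible W"
proof -
  have "u = 0" if "W *v u = 0" for u
  proof -
    have "W *v (- u) = 0" using that matrix_vector_mult_diff_distrib[of W 0 u] by simp
    then have "0 \<le> (- u) $ i" "0 \<le> u $ i" for i
      using that by (auto intro: mono[of "- u"] mono[of u] simp del: vector_uminus_component)
    then show ?thesis by (simp add: vec_eq_iff order_antisym)
  qed
  then show ?thesis
    by (simp add: invertible_left_inverse matrix_left_invertible_ker)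
qed

section \<open>Substochastic iterations\<close>

lemma invertible_matrix_inv:
  fixes A :: "real ^ 'n ^ 'n::finite"
  assumes "invertible A"
  shows "A ** matrix_inv A = mat 1" and "matrix_inv A ** A = mat 1"
  using someI_ex[OF assms[unfolded invertible_def]] by (simp_all add: matrix_inv_def)

lemma matrix_vector_mult_mono:
  fixes M :: "real ^ 'n ^ 'm::finite"
  assumes "\<And>i j. 0 \<le> M $ i $ j" and "\<And>j. u $ j \<le> w $ j"
  shows "(M *v u) $ i \<le> (M *v w) $ i"
  unfolding matrix_vector_mult_def using assms by (auto intro!: sum_mono mult_left_mono)

text \<open>
  The sequence \<open>M\<^sup>n 1\<close> plays the role of a norm estimate: it decreases to a fixed vector of \<open>M\<close>,
  which must be \<open>0\<close>, and by positivity of \<open>M\<close> it controls the powers applied to any other vector.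
\<close>

lemma substochastic_powers_tendsto_zero:
  fixes M :: "real ^ 'n ^ 'n::finite"
  assumes nonneg: "\<And>i j. 0 \<le> M $ i $ j"
    and row_sum: "\<And>i. (M *v 1) $ i \<le> 1"
    and no_fixed: "\<And>u. M *v u = u \<Longrightarrow> u = 0"
  shows "(\<lambda>n. ((*v) M ^^ n) u) \<longlonglongrightarrow> 0"
proof -
  define e where "e = (\<lambda>n. ((*v) M ^^ n) (1 :: real ^ 'n))"
  have e_Suc: "e (Suc n) = M *v e n" for n by (simp add: e_def)
  have e_dec: "e (Suc n) $ i \<le> e n $ i" for n i
  proof (induction n arbitrary: i)
    case 0
    then show ?case by (simp add: e_def row_sum)
  next
    case (Suc n)
    then show ?case unfolding e_Suc by (intro matrix_vector_mult_mono nonneg) (simp flip: e_Suc)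
  qed
  have e_nonneg: "0 \<le> e n $ i" for n i
  proof (induction n arbitrary: i)
    case (Suc n)
    have "(M *v 0) $ i \<le> (M *v e n) $ i"
      by (intro matrix_vector_mult_mono nonneg) (simp add: Suc)
    then show ?case by (simp add: e_Suc)
  qed (simp add: e_def)
  have "\<exists>l. (\<lambda>n. e n $ i) \<longlonglongrightarrow> l" for i
    using decseq_convergent[of "\<lambda>n. e n $ i" 0] e_dec e_nonneg by (metis decseq_SucI)
  then obtain l where l: "\<And>i. (\<lambda>n. e n $ i) \<longlonglongrightarrow> l i" by metis
  have lim: "e \<longlonglongrightarrow> (\<chi> i. l i)" by (rule vec_tendstoI) (simp add: l)
  have "(\<lambda>n. M *v e n) \<longlonglongrightarrow> M *v (\<chi> i. l i)"
    by (intro bounded_linear.tendsto[OF _ lim] matrix_vector_mul_bounded_linear)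
  moreover have "(\<lambda>n. M *v e n) \<longlonglongrightarrow> (\<chi> i. l i)"
    using LIMSEQ_Suc[OF lim] by (simp add: e_Suc)
  ultimately have "M *v (\<chi> i. l i) = (\<chi> i. l i)" by (rule LIMSEQ_unique)
  from no_fixed[OF this] have e_lim: "e \<longlonglongrightarrow> 0" using lim by simp
  define r where "r = norm u"
  have scaled: "M *v (a *\<^sub>R w) = a *\<^sub>R (M *v w)" for a w
    by (simp add: matrix_vector_mult_scaleR)
  have bound: "\<bar>((*v) M ^^ n) u $ i\<bar> \<le> r * e n $ i" for n i
  proof (induction n arbitrary: i)
    case 0
    then show ?case by (simp add: e_def r_def component_le_norm_cart)
  next
    case (Suc n)
    have "(M *v ((*v) M ^^ n) u) $ i \<le> (M *v (r *\<^sub>R e n)) $ i"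
      using Suc by (intro matrix_vector_mult_mono nonneg) (simp add: abs_le_iff)
    moreover have "(M *v ((- r) *\<^sub>R e n)) $ i \<le> (M *v ((*v) M ^^ n) u) $ i"
      using Suc by (intro matrix_vector_mult_mono nonneg) (simp add: abs_le_iff minus_le_iff)
    ultimately show ?case by (simp only: scaled) (simp add: e_Suc abs_le_iff)
  qed
  show ?thesis
  proof (rule vec_tendstoI)
    fix i
    have "(\<lambda>n. r * e n $ i) \<longlonglongrightarrow> r * (0 :: real ^ 'n) $ i"
      by (intro tendsto_intros e_lim)
    then have "(\<lambda>n. r * e n $ i) \<longlonglongrightarrow> 0" by simp
    then have "(\<lambda>n. ((*v) M ^^ n) u $ i) \<longlonglongrightarrow> 0"
      by (rule tendsto_0_le[where K = 1])
        (use bound e_nonneg in \<open>auto simp: r_def abs_mult intro!: always_eventually\<close>)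
    then show "(\<lambda>n. ((*v) M ^^ n) u $ i) \<longlonglongrightarrow> 0 $ i" by simp
  qed
qed

text \<open>
  The limit is the solution \<open>w\<close> of \<open>w = M w + q\<close>, which exists because \<open>Id - M\<close> has trivial kernel;
  the error \<open>v - w\<close> is multiplied by \<open>M\<close> in each step.
\<close>

lemma substochastic_iteration_convergent:
  fixes M :: "real ^ 'n ^ 'n::finite" and v :: "nat \<Rightarrow> real ^ 'n"
  assumes nonneg: "\<And>i j. 0 \<le> M $ i $ j"
    and row_sum: "\<And>i. (M *v 1) $ i \<le> 1"
    and no_fixed: "\<And>u. M *v u = u \<Longrightarrow> u = 0"
    and step: "\<forall>\<^sub>F k in sequentially. v (Suc k) = M *v v k + q"
  shows "convergent v"
proof -
  have "invertible (mat 1 - M)"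
    using no_fixed
    by (auto simp: invertible_left_inverse matrix_left_invertible_ker matrix_vector_mult_diff_rdistrib)
  then have "(mat 1 - M) *v (matrix_inv (mat 1 - M) *v q) = q"
    by (simp add: matrix_vector_mul_assoc invertible_matrix_inv)
  then obtain w where w: "w = M *v w + q"
    by (metis add.commute diff_add_cancel matrix_vector_mul_lid matrix_vector_mult_diff_rdistrib)
  obtain K where K: "\<And>k. k \<ge> K \<Longrightarrow> v (Suc k) = M *v v k + q"
    using step by (auto simp: eventually_sequentially)
  have error: "v (n + K) - w = ((*v) M ^^ n) (v K - w)" for n
  proof (induction n)
    case (Suc n)
    have "v (Suc n + K) - w = (M *v v (n + K) + q) - (M *v w + q)"
      using K[of "n + K"] w by simp
    also have "\<dots> = M *v (v (n + K) - w)"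
      by (simp add: matrix_vector_mult_diff_distrib)
    finally show ?case by (simp add: Suc)
  qed simp
  have "(\<lambda>n. v (n + K) - w) \<longlonglongrightarrow> 0"
    unfolding error by (rule substochastic_powers_tendsto_zero[OF nonneg row_sum no_fixed])
  then have "(\<lambda>n. v (n + K)) \<longlonglongrightarrow> w" by (rule LIM_zero_cancel)
  then have "v \<longlonglongrightarrow> w" by (rule LIMSEQ_offset)
  then show ?thesis by (rule convergentI)
qed

text \<open>
  All three conclusions come from testing the monotone matrices \<open>A\<close> and \<open>A - N\<close> on suitable vectors:
  the columns of \<open>M\<close>, which \<open>A\<close> maps to the columns of \<open>N\<close>; the vector \<open>1 - M 1\<close>, which \<open>A\<close> maps
  to the row sums of \<open>A - N\<close>; and a fixed vector of \<open>M\<close>, which lies in the kernel of \<open>A - N\<close>.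
\<close>

lemma regular_splitting_substochastic:
  fixes A N :: "real ^ 'n ^ 'n::finite"
  assumes mono_A: "\<And>u i. (\<And>j. 0 \<le> (A *v u) $ j) \<Longrightarrow> 0 \<le> u $ i"
    and mono_W: "\<And>u i. (\<And>j. 0 \<le> ((A - N) *v u) $ j) \<Longrightarrow> 0 \<le> u $ i"
    and N_nonneg: "\<And>i j. 0 \<le> N $ i $ j"
    and row_sum: "\<And>i. 0 \<le> ((A - N) *v 1) $ i"
  defines "M \<equiv> matrix_inv A ** N"
  shows "0 \<le> M $ i $ j" and "(M *v 1) $ i \<le> 1" and "M *v u = u \<Longrightarrow> u = 0"
proof -
  have "invertible A" using mono_A by (rule monotone_matrix_invertible)
  then have AM: "A *v (M *v w) = N *v w" for w
    by (simp add: M_def matrix_vector_mul_assoc matrix_mul_assoc invertible_matrix_inv)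
  have "A *v column j M = column j N"
    using AM[of "axis j 1"] by (simp add: matrix_vector_mult_basis)
  then have "0 \<le> (A *v column j M) $ k" for k using N_nonneg by (simp add: column_def)
  then have "0 \<le> column j M $ i" by (rule mono_A)
  then show "0 \<le> M $ i $ j" by (simp add: column_def)
  have "0 \<le> (1 - M *v 1) $ i"
    by (rule mono_A) (use row_sum in
        \<open>simp add: matrix_vector_mult_diff_distrib AM matrix_vector_mult_diff_rdistrib\<close>)
  then show "(M *v 1) $ i \<le> 1" by simp
  assume "M *v u = u"
  then have "(A - N) *v u = 0" using AM[of u] by (simp add: matrix_vector_mult_diff_rdistrib)
  moreover have "invertible (A - N)" using mono_W by (rule monotone_matrix_invertible)
  ultimately show "u = 0"
    by (simp add: invertible_left_inverse matrix_left_invertible_ker)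
qed

text \<open>
  Removing the limit from the finite range leaves a closed set, whose complement is a neighbourhood
  of the limit.
\<close>

lemma convergent_finite_range_eventually_constant:
  fixes X :: "nat \<Rightarrow> 'a::t1_space"
  assumes "finite (range X)" and "convergent X"
  obtains l where "\<forall>\<^sub>F k in sequentially. X k = l"
proof -
  obtain l where l: "X \<longlonglongrightarrow> l" using assms(2) by (auto simp: convergent_def)
  have "open (- (range X - {l}))"
    using assms(1) by (intro open_Compl finite_imp_closed) auto
  from topological_tendstoD[OF l this] have "\<forall>\<^sub>F k in sequentially. X k = l"
    by (auto elim: eventually_mono)
  then show thesis by (rule that)
qed

section \<open>Row structure of the coefficients\<close>

lemma mirror_mirror: "sym_grid pt \<Longrightarrow> mirror pt (mirror pt x) = x"
  by (metis minus_minus pt_mirror sym_grid_def injD)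

lemma indicator_mirror:
  "sym_grid pt \<Longrightarrow> indicator I (mirror pt x) = (indicator (mirror pt ` I) x :: real)"
  by (force simp: indicator_def mirror_mirror image_iff)

lemma symm_mat_nth: "symm_mat pt $ i $ j = (if mirror pt i = j then 1 else 0)"
  by (simp add: symm_mat_def matrix_def symm_def axis_def)

text \<open>
  Conjugation by \<open>S\<close> reflects both indices of a matrix; in particular \<open>S \<Psi> S\<close> is the indicator
  matrix of \<open>- I\<close>.
\<close>

lemma symm_mat_conjugate_nth:
  assumes "sym_grid pt"
  shows "(symm_mat pt ** X ** symm_mat pt) $ i $ j = X $ mirror pt i $ mirror pt j"
proof -
  have *: "mirror pt k = j \<longleftrightarrow> k = mirror pt j" for k
    using mirror_mirror[OF assms] by auto
  show ?thesis
    by (simp add: matrix_matrix_mult_def symm_mat_nth if_distrib if_distribR * cong: if_cong)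
qed

lemma diag_ind_nth: "diag_ind I $ i $ j = (if i = j then indicator I i else 0)"
  by (simp add: diag_ind_def)

lemma diag_ind_mult_nth: "(diag_ind I ** X) $ i $ j = indicator I i * X $ i $ j"
  by (simp add: matrix_matrix_mult_def diag_ind_nth if_distrib if_distribR cong: if_cong)

lemma diag_ind_mult_vec_nth: "(diag_ind I *v u) $ i = indicator I i * u $ i"
  by (simp add: matrix_vector_mult_def diag_ind_nth if_distrib if_distribR cong: if_cong)

lemma symm_mat_conjugate_diag_ind:
  assumes "sym_grid pt"
  shows "symm_mat pt ** diag_ind I ** symm_mat pt = diag_ind (mirror pt ` I)"
proof -
  have "mirror pt i = mirror pt j \<longleftrightarrow> i = j" for i j
    using mirror_mirror[OF assms] by metis
  then show ?thesis
    by (simp add: vec_eq_iff symm_mat_conjugate_nth assms diag_ind_nth indicator_mirror)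
qed

lemma diag_ind_complement:
  assumes "I' \<inter> J = {}"
  shows "mat 1 - diag_ind I' - diag_ind J = diag_ind (- I' \<inter> - J)"
  using assms by (auto simp: vec_eq_iff diag_ind_nth mat_def indicator_def)

text \<open>
  The defining formula of \<open>A\<close> is a disguised case distinction: since \<open>I'\<close> and \<open>- I\<close> are disjoint,
  every row is a row of \<open>Id - B(\<delta>')\<close>, of \<open>Id\<close>, or of \<open>- L\<close>, according to the region of its node.
\<close>

lemma coeff_A_row:
  assumes "sym_grid pt" and "I' \<inter> mirror pt ` I = {}"
  shows "coeff_A pt L B (I, \<delta>) (I', \<delta>') $ i =
    (if i \<in> I' then (mat 1 - B \<delta>') $ i
     else if i \<in> mirror pt ` I then mat 1 $ i else (- L) $ i)"
  using assms(2)
  by (auto simp: vec_eq_iff symm_mat_conjugate_diag_ind[OF assms(1)] diag_ind_complement[OF assms(2)]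
      diag_ind_mult_nth)

lemma coeff_B_nth:
  assumes "sym_grid pt"
  shows "coeff_B pt B (I, \<delta>) $ i $ j =
    (if i \<in> mirror pt ` I then B \<delta> $ mirror pt i $ mirror pt j else 0)"
proof -
  have "coeff_B pt B (I, \<delta>) = symm_mat pt ** (diag_ind I ** B \<delta>) ** symm_mat pt"
    by (simp add: matrix_mul_assoc)
  then show ?thesis
    by (simp add: symm_mat_conjugate_nth assms diag_ind_mult_nth indicator_mirror)
qed

lemma coeff_C_nth:
  assumes "sym_grid pt" and "I' \<inter> mirror pt ` I = {}"
  shows "coeff_C pt f c g (I, \<delta>) (I', \<delta>') $ i =
    (if i \<in> I' then - c \<delta>' $ i
     else if i \<in> mirror pt ` I then g (symm pt \<delta>) $ i else f $ i)"
  using assms(2)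
  by (auto simp: symm_mat_conjugate_diag_ind[OF assms(1)] diag_ind_complement[OF assms(2)]
      diag_ind_mult_vec_nth)

declare coeff_A.simps [simp del] coeff_B.simps [simp del] coeff_C.simps [simp del]

lemma coeff_B_mult_vec_nth:
  assumes "sym_grid pt"
  shows "(coeff_B pt B (I, \<delta>) *v u) $ i =
    (if i \<in> mirror pt ` I then symm pt (B \<delta> *v symm pt u) $ i else 0)"
proof -
  have "bij (mirror pt)"
    by (rule involuntory_imp_bij) (rule mirror_mirror[OF assms])
  then have "(\<Sum>j\<in>UNIV. B \<delta> $ mirror pt i $ mirror pt j * u $ j)
      = (\<Sum>j\<in>UNIV. B \<delta> $ mirror pt i $ j * u $ mirror pt j)"
    by (subst sum.reindex_bij_betw[symmetric, of "mirror pt"]) (auto simp: mirror_mirror[OF assms])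
  then show ?thesis
    by (simp add: matrix_vector_mult_def coeff_B_nth[OF assms] symm_def)
qed

lemma dominant_row_sum:
  fixes A :: "real ^ 'n ^ 'n::finite"
  assumes "L0_matrix A"
  shows "wdd A \<Longrightarrow> 0 \<le> (A *v 1) $ i" and "sdd A \<Longrightarrow> 0 < (A *v 1) $ i"
proof -
  have "(A *v 1) $ i = A $ i $ i + (\<Sum>j\<in>UNIV - {i}. A $ i $ j)"
    by (simp add: matrix_vector_mult_def sum.remove[of UNIV i])
  moreover have "(\<Sum>j\<in>UNIV - {i}. \<bar>A $ i $ j\<bar>) = - (\<Sum>j\<in>UNIV - {i}. A $ i $ j)"
    unfolding sum_negf[symmetric] using assms by (intro sum.cong) (auto simp: L0_matrix_def)
  moreover have "\<bar>A $ i $ i\<bar> = A $ i $ i" using assms by (simp add: L0_matrix_def)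
  ultimately show "wdd A \<Longrightarrow> 0 \<le> (A *v 1) $ i" "sdd A \<Longrightarrow> 0 < (A *v 1) $ i"
    unfolding wdd_def sdd_def wdd_row_def sdd_row_def
    by (metis add.inverse_inverse diff_ge_0_iff_ge diff_gt_0_iff_gt diff_minus_eq_add)+
qed

section \<open>Optimal controls\<close>

lemma finite_controls:
  fixes Z :: "'g::finite \<Rightarrow> real set"
  assumes "\<And>x. finite (Z x)"
  shows "finite (controls Z)"
proof (rule finite_subset)
  show "controls Z \<subseteq> vec_lambda ` (PiE UNIV Z)"
  proof
    fix \<delta> assume "\<delta> \<in> controls Z"
    then have "vec_nth \<delta> \<in> PiE UNIV Z" by (auto simp: controls_def)
    then show "\<delta> \<in> vec_lambda ` (PiE UNIV Z)" by (metis image_eqI vec_nth_inverse)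
  qed
  show "finite (vec_lambda ` (PiE UNIV Z))"
    using assms by (intro finite_imageI finite_PiE) auto
qed

lemma finite_strategies:
  fixes pt :: "'g::finite \<Rightarrow> real"
  assumes "\<And>x. finite (Z x)"
  shows "finite (strategies pt Z)"
  by (rule finite_subset[of _ "UNIV \<times> controls Z"])
    (auto simp: strategies_def finite_controls[OF assms])

lemma controls_nonempty:
  assumes "\<And>x. Z x \<noteq> {}"
  shows "controls Z \<noteq> {}"
proof -
  have "(\<chi> x. SOME z. z \<in> Z x) \<in> controls Z"
    using assms by (simp add: controls_def some_in_eq)
  then show ?thesis by blast
qed

lemma gain_row_cong:
  assumes "row_decoupled pt Z B c g" "\<delta> \<in> controls Z" "\<delta>' \<in> controls Z" "\<delta> $ x = \<delta>' $ x"
  shows "(B \<delta> *v w - c \<delta>) $ x = (B \<delta>' *v w - c \<delta>') $ x"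
proof -
  have "row x (B \<delta>) = row x (B \<delta>')" "c \<delta> $ x = c \<delta>' $ x"
    using assms unfolding row_decoupled_def by blast+
  then show ?thesis by (simp add: matrix_vector_mult_def row_def vec_eq_iff)
qed

text \<open>
  Taking the largest maximizer at each node separately could leave the set of maximizers. It does
  not, because rows are decoupled: a control glued from maximizers, a different one at each node, is
  again a maximizer. The same gluing shows that the row-wise maximum \<open>gain_op\<close> is attained by one
  control in all rows at once.
\<close>

lemma opt_control_in_maximizers:
  assumes Z_finite: "\<And>x. finite (Z x)" and Z_nonempty: "\<And>x. Z x \<noteq> {}"
    and decoupled: "row_decoupled pt Z B c g"
  shows "opt_control Z B c w \<in> maximizers Z B c w"
proof -
  have fin: "finite (controls Z)" by (rule finite_controls[OF Z_finite])
  have ne: "controls Z \<noteq> {}" by (rule controls_nonempty[OF Z_nonempty])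
  have glue: "(\<chi> x. d x $ x) \<in> maximizers Z B c w"
    if d: "\<And>x. d x \<in> controls Z" "\<And>x. (B (d x) *v w - c (d x)) $ x = gain_op Z B c w $ x" for d
  proof -
    have mem: "(\<chi> x. d x $ x) \<in> controls Z" using d(1) by (simp add: controls_def)
    have "(B (\<chi> x. d x $ x) *v w - c (\<chi> x. d x $ x)) $ x = gain_op Z B c w $ x" for x
      using gain_row_cong[OF decoupled mem d(1)[of x], of x w] d(2)[of x] by simp
    with mem show ?thesis by (simp add: maximizers_def vec_eq_iff)
  qed
  have "\<exists>\<delta>\<in>controls Z. (B \<delta> *v w - c \<delta>) $ x = gain_op Z B c w $ x" for x
  proof -
    have "gain_op Z B c w $ x \<in> (\<lambda>\<delta>. (B \<delta> *v w - c \<delta>) $ x) ` controls Z"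
      unfolding gain_op_def vec_lambda_beta using fin ne by (intro Max_in) auto
    then show ?thesis by auto
  qed
  then obtain d where "\<And>x. d x \<in> controls Z"
    "\<And>x. (B (d x) *v w - c (d x)) $ x = gain_op Z B c w $ x" by metis
  then have max_ne: "maximizers Z B c w \<noteq> {}" using glue by blast
  have max_fin: "finite (maximizers Z B c w)"
    using fin by (rule finite_subset[rotated]) (auto simp: maximizers_def)
  have "\<exists>\<delta>\<in>maximizers Z B c w. opt_control Z B c w $ x = \<delta> $ x" for x
  proof -
    have "opt_control Z B c w $ x \<in> (\<lambda>\<delta>. \<delta> $ x) ` maximizers Z B c w"
      unfolding opt_control_def vec_lambda_beta using max_fin max_ne by (intro Max_in) auto
    then show ?thesis by auto
  qed
  then obtain d' where d': "\<And>x. d' x \<in> maximizers Z B c w"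
    "\<And>x. opt_control Z B c w $ x = d' x $ x" by metis
  have "opt_control Z B c w = (\<chi> x. d' x $ x)" using d'(2) by (simp add: vec_eq_iff)
  moreover have "(\<chi> x. d' x $ x) \<in> maximizers Z B c w"
    using d'(1) by (intro glue) (auto simp: maximizers_def)
  ultimately show ?thesis by simp
qed

text \<open>
  At nonnegative nodes an impulse leaves the state unchanged but costs \<open>c > 0\<close>, so intervening is
  never optimal there. This keeps the impulse regions inside the negative half of the grid.
\<close>

lemma gain_op_less_nonneg_node:
  fixes pt :: "'g::finite \<Rightarrow> real"
  assumes "\<And>x. finite (Z x)" and "\<And>x. Z x \<noteq> {}"
    and c_pos: "\<And>\<delta> x. \<delta> \<in> controls Z \<Longrightarrow> c \<delta> $ x > 0"
    and B_nonneg: "\<And>\<delta> x. \<delta> \<in> controls Z \<Longrightarrow> pt x \<ge> 0 \<Longrightarrow> row x (B \<delta>) = row x (mat 1)"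
    and x: "pt x \<ge> 0"
  shows "gain_op Z B c w $ x < w $ x"
proof -
  have "(B \<delta> *v w - c \<delta>) $ x < w $ x" if "\<delta> \<in> controls Z" for \<delta>
  proof -
    have "B \<delta> $ x $ j = mat 1 $ x $ j" for j
      using B_nonneg[OF that x] by (simp add: row_def vec_eq_iff)
    then have "(B \<delta> *v w) $ x = (mat 1 *v w) $ x" by (simp add: matrix_vector_mult_def)
    then show ?thesis using c_pos[OF that, of x] by simp
  qed
  then show ?thesis
    unfolding gain_op_def vec_lambda_beta
    using finite_controls[of Z, OF assms(1)] controls_nonempty[of Z, OF assms(2)]
    by (subst Max_less_iff) auto
qed

text \<open>
  The test defining \<open>I'\<close> decides which term attains the maximum in the equation
  \<open>max {L u + f, M u - u} = 0\<close>, where \<open>M\<close> is \<open>gain_op\<close>. Where \<open>L u + f \<le> \<lambda> (M u - u)\<close>, the second term vanishes: otherwise it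
  would be negative and the first one, being \<open>0\<close>, would exceed \<open>\<lambda>\<close> times it. Where the inequality
  fails, the first term vanishes: otherwise it would be negative and the second one \<open>0\<close>, so that the
  inequality would hold.
\<close>

lemma iterate_linear_system:
  fixes pt :: "'g::finite \<Rightarrow> real"
  assumes grid: "sym_grid pt"
    and lam_pos: "lam > 0"
    and max: "\<delta>' \<in> maximizers Z B c u"
    and solves: "solves_qvi L f Z B c (- (mirror pt ` I)) (half_step pt B g (I, \<delta>) w) u"
    and I': "I' = {x \<in> - (mirror pt ` I). (L *v u + f) $ x \<le> lam * (gain_op Z B c u - u) $ x}"
  shows "coeff_A pt L B (I, \<delta>) (I', \<delta>') *v u
    = coeff_B pt B (I, \<delta>) *v w + coeff_C pt f c g (I, \<delta>) (I', \<delta>')"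
proof -
  have disj: "I' \<inter> mirror pt ` I = {}" using I' by auto
  note A_row = coeff_A_row[OF grid disj, of L B \<delta> \<delta>']
  have row_mult: "(X *v u) $ x = (Y *v u) $ x" if "X $ x = Y $ x" for X Y :: "real ^ 'g ^ 'g" and x
    using that by (simp add: matrix_vector_mult_def)
  have gain: "gain_op Z B c u = B \<delta>' *v u - c \<delta>'" using max by (simp add: maximizers_def)
  have "(coeff_A pt L B (I, \<delta>) (I', \<delta>') *v u) $ x
    = (coeff_B pt B (I, \<delta>) *v w + coeff_C pt f c g (I, \<delta>) (I', \<delta>')) $ x" for x
  proof -
    consider (impulse) "x \<in> I'" | (opponent) "x \<in> mirror pt ` I" "x \<notin> I'"
      | (continuation) "x \<notin> I'" "x \<notin> mirror pt ` I" by blast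
    then show ?thesis
    proof cases
      case impulse
      then have x: "x \<notin> mirror pt ` I" using disj by blast
      have le: "(L *v u + f) $ x \<le> lam * (gain_op Z B c u - u) $ x" using impulse I' by simp
      have "max ((L *v u + f) $ x) ((gain_op Z B c u - u) $ x) = 0"
        using solves x by (simp add: solves_qvi_def)
      then have "(gain_op Z B c u - u) $ x = 0"
        using le mult_pos_neg[OF lam_pos, of "(gain_op Z B c u - u) $ x"]
        by (fastforce simp: max_def split: if_splits)
      moreover have "(coeff_A pt L B (I, \<delta>) (I', \<delta>') *v u) $ x = ((mat 1 - B \<delta>') *v u) $ x"
        using impulse by (intro row_mult) (simp add: A_row)
      ultimately show ?thesis using impulse x
        by (simp add: coeff_B_mult_vec_nth[OF grid] coeff_C_nth[OF grid disj] gain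
            matrix_vector_mult_diff_rdistrib)
    next
      case opponent
      have "(coeff_A pt L B (I, \<delta>) (I', \<delta>') *v u) $ x = (mat 1 *v u) $ x"
        using opponent by (intro row_mult) (simp add: A_row)
      moreover have "u $ x = opponent_op pt B g \<delta> w $ x"
        using solves opponent unfolding solves_qvi_def half_step_def by auto
      ultimately show ?thesis using opponent
        by (simp add: coeff_B_mult_vec_nth[OF grid] coeff_C_nth[OF grid disj] opponent_op_def)
    next
      case continuation
      have gt: "(L *v u + f) $ x > lam * (gain_op Z B c u - u) $ x"
        using continuation I' by auto
      have "max ((L *v u + f) $ x) ((gain_op Z B c u - u) $ x) = 0"
        using solves continuation by (simp add: solves_qvi_def)
      then have "(L *v u + f) $ x = 0"
        using gt by (cases "(gain_op Z B c u - u) $ x = 0") (auto simp: max_def split: if_splits)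
      moreover have "(coeff_A pt L B (I, \<delta>) (I', \<delta>') *v u) $ x = ((- L) *v u) $ x"
        using continuation by (intro row_mult) (simp add: A_row)
      moreover have "(- L) *v u = - (L *v u)"
        using matrix_vector_mult_diff_rdistrib[of 0 L u] by simp
      ultimately show ?thesis using continuation
        by (simp add: coeff_B_mult_vec_nth[OF grid] coeff_C_nth[OF grid disj])
    qed
  qed
  then show ?thesis by (simp add: vec_eq_iff)
qed

section \<open>Convergence of the iterates\<close>

text \<open>
  The row sums of \<open>A - N\<close> are those of \<open>Id - B(\<delta>')\<close> on \<open>I'\<close>, the reflected ones of \<open>Id - B(\<delta>)\<close> on
  \<open>- I\<close>, and those of \<open>- L\<close> elsewhere, where they are positive; this is the common continuation
  region in which the walks of (A0') end. The walks live in the graph of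
  \<open>\<Psi>' B(\<delta>') + S \<Psi> B(\<delta>) S\<close>, whose edges are, up to loops, those that \<open>A - N\<close> has in rows of
  \<open>I' \<union> - I\<close>. For \<open>A\<close> the edges out of \<open>- I\<close> are missing, but there \<open>A\<close> has row sum \<open>1\<close>.
\<close>

lemma strategy_splitting_monotone:
  fixes pt :: "'g::finite \<Rightarrow> real"
  assumes grid: "sym_grid pt"
    and A0': "\<And>x. x \<in> I' \<union> mirror pt ` I \<Longrightarrow>
        \<exists>y \<in> - I' \<inter> - (mirror pt ` I).
          (x, y) \<in> (matrix_graph (diag_ind I' ** B \<delta>'
                       + symm_mat pt ** diag_ind I ** B \<delta> ** symm_mat pt))\<^sup>+"
    and A1_L: "sdd (- L)" "L0_matrix (- L)"
    and A1_B: "wdd (mat 1 - B \<delta>)" "L0_matrix (mat 1 - B \<delta>)"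
    and A1_B': "wdd (mat 1 - B \<delta>')" "L0_matrix (mat 1 - B \<delta>')"
    and A2: "\<And>x. B \<delta> $ x $ x \<ge> 0"
    and disj: "I' \<inter> mirror pt ` I = {}"
  defines "A \<equiv> coeff_A pt L B (I, \<delta>) (I', \<delta>')" and "N \<equiv> coeff_B pt B (I, \<delta>)"
  shows "0 \<le> N $ i $ j"
    and "0 \<le> ((A - N) *v 1) $ i"
    and "(\<And>j. 0 \<le> (A *v u) $ j) \<Longrightarrow> 0 \<le> u $ i"
    and "(\<And>j. 0 \<le> ((A - N) *v u) $ j) \<Longrightarrow> 0 \<le> u $ i"
proof -
  define R where "R = matrix_graph (diag_ind I' ** B \<delta>'
    + symm_mat pt ** diag_ind I ** B \<delta> ** symm_mat pt)"
  have A_row: "A $ i = (if i \<in> I' then (mat 1 - B \<delta>') $ i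
     else if i \<in> mirror pt ` I then mat 1 $ i else (- L) $ i)" for i
    unfolding A_def by (rule coeff_A_row[OF grid disj])
  have N_nth: "N $ i $ j = (if i \<in> mirror pt ` I then B \<delta> $ mirror pt i $ mirror pt j else 0)" for i j
    unfolding N_def by (rule coeff_B_nth[OF grid])
  have mirror_inj: "mirror pt i \<noteq> mirror pt j" if "i \<noteq> j" for i j
    using that mirror_mirror[OF grid] by metis
  have R_matrix: "(diag_ind I' ** B \<delta>' + symm_mat pt ** diag_ind I ** B \<delta> ** symm_mat pt) $ i $ j
     = indicator I' i * B \<delta>' $ i $ j + N $ i $ j" for i j
    unfolding N_def coeff_B.simps by (simp add: diag_ind_mult_nth)
  have R_iff: "(i, j) \<in> R \<longleftrightarrow> (if i \<in> I' then B \<delta>' $ i $ j \<noteq> 0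
     else i \<in> mirror pt ` I \<and> B \<delta> $ mirror pt i $ mirror pt j \<noteq> 0)" for i j
  proof -
    have "i \<notin> mirror pt ` I" if "i \<in> I'" using that disj by blast
    then show ?thesis
      unfolding R_def matrix_graph_def mem_Collect_eq prod.case R_matrix N_nth
      by (cases "i \<in> I'") simp_all
  qed
  have row_mult: "(X *v w) $ x = (Y *v w) $ x" if "X $ x = Y $ x" for X Y :: "real ^ 'g ^ 'g" and x w
    using that by (simp add: matrix_vector_mult_def)
  have B_entry: "0 \<le> B \<delta> $ i $ j" for i j
    using A2[of i] A1_B(2) by (cases "i = j") (force simp: L0_matrix_def mat_def)+
  show N_nonneg: "0 \<le> N $ i $ j" for i j by (simp add: N_nth B_entry)
  have N_one: "(N *v 1) $ i = (if i \<in> mirror pt ` I then (B \<delta> *v 1) $ mirror pt i else 0)" for i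
  proof -
    have "symm pt 1 = (1 :: real ^ 'g)" by (simp add: symm_def vec_eq_iff)
    then show ?thesis
      unfolding N_def coeff_B_mult_vec_nth[OF grid] by (simp add: symm_def)
  qed
  have A_one: "(A *v 1) $ i = (if i \<in> I' then ((mat 1 - B \<delta>') *v 1) $ i
     else if i \<in> mirror pt ` I then 1 else ((- L) *v 1) $ i)" for i
    using row_mult[of A i "mat 1 - B \<delta>'" 1] row_mult[of A i "mat 1" 1] row_mult[of A i "- L" 1]
      A_row[of i] by auto
  have L_pos: "0 < ((- L) *v 1) $ i" for i by (rule dominant_row_sum(2)[OF A1_L(2,1)])
  have B'_le: "0 \<le> ((mat 1 - B \<delta>') *v 1) $ i" for i by (rule dominant_row_sum(1)[OF A1_B'(2,1)])
  have B_le: "0 \<le> ((mat 1 - B \<delta>) *v 1) $ i" for i by (rule dominant_row_sum(1)[OF A1_B(2,1)])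
  show W_sum: "0 \<le> ((A - N) *v 1) $ i" for i
    using B'_le[of i] B_le[of "mirror pt i"] L_pos[of i] disj
    by (auto simp: matrix_vector_mult_diff_rdistrib[of A N] A_one N_one
        matrix_vector_mult_diff_rdistrib[of "mat 1" "B \<delta>"] less_imp_le)
  have W_pos: "0 < ((A - N) *v 1) $ i" if "i \<in> - I' \<inter> - (mirror pt ` I)" for i
    using that L_pos[of i] by (simp add: matrix_vector_mult_diff_rdistrib[of A N] A_one N_one)
  have A_sum: "((A - N) *v 1) $ i \<le> (A *v 1) $ i" for i
  proof -
    have "(N *v 0) $ i \<le> (N *v 1) $ i" by (intro matrix_vector_mult_mono N_nonneg) simp
    then show ?thesis by (simp add: matrix_vector_mult_diff_rdistrib)
  qed
  have A_off: "A $ i $ j \<le> 0" if "i \<noteq> j" for i j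
    using that A1_L(2) A1_B'(2) by (auto simp: A_row L0_matrix_def mat_def)
  have W_off: "(A - N) $ i $ j \<le> 0" if "i \<noteq> j" for i j
    using A_off[OF that] N_nonneg[of i j] by simp
  have chain: "\<exists>j. (i, j) \<in> R\<^sup>* \<and> 0 < ((A - N) *v 1) $ j" for i
  proof (cases "i \<in> I' \<union> mirror pt ` I")
    case True
    from A0'[OF this] W_pos show ?thesis unfolding R_def by (meson trancl_into_rtrancl)
  next
    case False
    then show ?thesis using W_pos[of i] by auto
  qed
  have W_edge: "i = j \<or> (A - N) $ i $ j \<noteq> 0" if "(i, j) \<in> R" for i j
  proof (cases "i \<in> I'")
    case True
    then have "i \<notin> mirror pt ` I" using disj by blast
    with True that show ?thesis by (simp add: R_iff A_row N_nth mat_def)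
  next
    case False
    with that mirror_inj[of i j] show ?thesis by (simp add: R_iff A_row N_nth mat_def)
  qed
  show "0 \<le> u $ i" if "\<And>j. 0 \<le> ((A - N) *v u) $ j"
  proof (rule weakly_chained_monotone[of "A - N" R])
    show "k = l \<or> (A - N) $ k $ l \<noteq> 0" if "(k, l) \<in> R" for k l using that by (rule W_edge)
  qed (fact W_off W_sum chain that)+
  have A_edge: "i = j \<or> A $ i $ j \<noteq> 0" if "(i, j) \<in> R" "(A *v 1) $ i = 0" for i j
    using that by (simp add: R_iff A_row A_one mat_def split: if_splits)
  show "0 \<le> u $ i" if "\<And>j. 0 \<le> (A *v u) $ j"
  proof (rule weakly_chained_monotone[of A R])
    show "0 \<le> (A *v 1) $ k" for k using W_sum[of k] A_sum[of k] by linarith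
    show "\<exists>j. (k, j) \<in> R\<^sup>* \<and> 0 < (A *v 1) $ j" for k
      using chain[of k] A_sum by (meson less_le_trans)
  qed (fact A_off A_edge that)+
qed

theorem theorem2p5p4:
  fixes pt :: "'g::finite \<Rightarrow> real"
    and L :: "real ^ 'g ^ 'g"
    and f :: "real ^ 'g"
    and Z :: "'g \<Rightarrow> real set"
    and B :: "real ^ 'g \<Rightarrow> real ^ 'g ^ 'g"
    and c g :: "real ^ 'g \<Rightarrow> real ^ 'g"
    and lam :: real
    and v :: "nat \<Rightarrow> real ^ 'g"
    and \<phi> :: "nat \<Rightarrow> 'g set \<times> (real ^ 'g)"
  assumes grid: "sym_grid pt"
    and Z_finite: "\<And>x. finite (Z x)"
    and Z_nonempty: "\<And>x. Z x \<noteq> {}"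
    and Z_nonneg: "\<And>x. pt x \<ge> 0 \<Longrightarrow> Z x = {0}"
    and c_pos: "\<And>\<delta> x. \<delta> \<in> controls Z \<Longrightarrow> c \<delta> $ x > 0"
    and decoupled: "row_decoupled pt Z B c g"
    and B_nonneg: "\<And>\<delta> x. \<delta> \<in> controls Z \<Longrightarrow> pt x \<ge> 0 \<Longrightarrow> row x (B \<delta>) = row x (mat 1)"
    and lam_pos: "lam > 0"
    and A0': "\<And>I \<delta> I' \<delta>' x.
        (I, \<delta>) \<in> strategies pt Z \<Longrightarrow> (I', \<delta>') \<in> strategies pt Z \<Longrightarrow>
        x \<in> I' \<union> mirror pt ` I \<Longrightarrow>
        \<exists>y \<in> - I' \<inter> - (mirror pt ` I).
          (x, y) \<in> (matrix_graph (diag_ind I' ** B \<delta>'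
                       + symm_mat pt ** diag_ind I ** B \<delta> ** symm_mat pt))\<^sup>+"
    and A1_L: "sdd (- L)" "L0_matrix (- L)"
    and A1_B: "\<And>\<delta>. \<delta> \<in> controls Z \<Longrightarrow> wdd (mat 1 - B \<delta>)"
              "\<And>\<delta>. \<delta> \<in> controls Z \<Longrightarrow> L0_matrix (mat 1 - B \<delta>)"
    and A2: "\<And>\<delta> x. \<delta> \<in> controls Z \<Longrightarrow> B \<delta> $ x $ x \<ge> 0"
    and algorithm: "generated_by_algorithm pt L f Z B c g lam v \<phi>"
    and conv_B: "convergent (\<lambda>k. inv_A_B pt L B (\<phi> k) (\<phi> (Suc k)))"
    and conv_C: "convergent (\<lambda>k. inv_A_C pt L f B c g (\<phi> k) (\<phi> (Suc k)))"
  shows "convergent v"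
proof -
  let ?J = "\<lambda>k. mirror pt ` fst (\<phi> k)"
  note alg = algorithm[unfolded generated_by_algorithm_def Let_def]
  have solves: "solves_qvi L f Z B c (- ?J k) (half_step pt B g (\<phi> k) (v k)) (v (Suc k))" for k
    using alg by blast
  have next_I: "fst (\<phi> (Suc k)) = {x \<in> - ?J k.
      (L *v v (Suc k) + f) $ x \<le> lam * (gain_op Z B c (v (Suc k)) - v (Suc k)) $ x}" for k
    using alg by blast
  have control: "snd (\<phi> k) = opt_control Z B c (v k)" for k
    using alg by (cases k) auto
  have maximal: "snd (\<phi> k) \<in> maximizers Z B c (v k)" for k
    unfolding control by (rule opt_control_in_maximizers[OF Z_finite Z_nonempty decoupled])
  \<comment> \<open>At a nonnegative node \<open>gain_op v < v\<close>, so the maximum in the equation forces \<open>L v + f = 0\<close> and the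
     test fails.\<close>
  have region: "fst (\<phi> k) \<subseteq> grid_neg pt" for k
  proof (cases k)
    case 0
    then show ?thesis using alg by auto
  next
    case (Suc n)
    show ?thesis
    proof
      fix x assume x: "x \<in> fst (\<phi> k)"
      show "x \<in> grid_neg pt"
      proof (rule ccontr)
        assume "x \<notin> grid_neg pt"
        then have "gain_op Z B c (v k) $ x < v k $ x"
          by (intro gain_op_less_nonneg_node[OF Z_finite Z_nonempty c_pos B_nonneg])
            (auto simp: grid_neg_def)
        then have "lam * (gain_op Z B c (v k) - v k) $ x < 0" "(gain_op Z B c (v k) - v k) $ x < 0"
          using lam_pos by (auto simp: mult_pos_neg)
        moreover have "(L *v v k + f) $ x \<le> lam * (gain_op Z B c (v k) - v k) $ x" "x \<in> - ?J n"
          using x next_I[of n] Suc by auto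
        moreover have "max ((L *v v k + f) $ x) ((gain_op Z B c (v k) - v k) $ x) = 0"
          using solves[of n] \<open>x \<in> - ?J n\<close> Suc unfolding solves_qvi_def by blast
        ultimately show False by linarith
      qed
    qed
  qed
  have strategy: "\<phi> k \<in> strategies pt Z" for k
    using region[of k] maximal[of k] by (auto simp: strategies_def maximizers_def case_prod_unfold)
  let ?A = "\<lambda>k. coeff_A pt L B (\<phi> k) (\<phi> (Suc k))" and ?N = "\<lambda>k. coeff_B pt B (\<phi> k)"
  have mono_A: "(\<And>j. 0 \<le> (?A k *v u) $ j) \<Longrightarrow> 0 \<le> u $ i"
    and mono_W: "(\<And>j. 0 \<le> ((?A k - ?N k) *v u) $ j) \<Longrightarrow> 0 \<le> u $ i"
    and N_nonneg: "0 \<le> ?N k $ i $ j"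
    and row_sum: "0 \<le> ((?A k - ?N k) *v 1) $ i" for k u i j
  proof -
    obtain I \<delta> I' \<delta>' where \<phi>: "\<phi> k = (I, \<delta>)" "\<phi> (Suc k) = (I', \<delta>')" by (metis surj_pair)
    have str: "(I, \<delta>) \<in> strategies pt Z" "(I', \<delta>') \<in> strategies pt Z"
      using strategy[of k] strategy[of "Suc k"] \<phi> by auto
    then have ctrl: "\<delta> \<in> controls Z" "\<delta>' \<in> controls Z" by (auto simp: strategies_def)
    have disj: "I' \<inter> mirror pt ` I = {}" using next_I[of k] \<phi> by auto
    note split = strategy_splitting_monotone[of pt I' I B \<delta>' \<delta> L, OF grid A0'[OF str] A1_L
        A1_B(1)[OF ctrl(1)] A1_B(2)[OF ctrl(1)] A1_B(1)[OF ctrl(2)] A1_B(2)[OF ctrl(2)]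
        A2[OF ctrl(1)] disj]
    show "(\<And>j. 0 \<le> (?A k *v u) $ j) \<Longrightarrow> 0 \<le> u $ i"
      "(\<And>j. 0 \<le> ((?A k - ?N k) *v u) $ j) \<Longrightarrow> 0 \<le> u $ i"
      "0 \<le> ?N k $ i $ j" "0 \<le> ((?A k - ?N k) *v 1) $ i"
      unfolding \<phi> using split by blast+
  qed
  let ?M = "\<lambda>k. inv_A_B pt L B (\<phi> k) (\<phi> (Suc k))"
    and ?q = "\<lambda>k. inv_A_C pt L f B c g (\<phi> k) (\<phi> (Suc k))"
  have substochastic: "0 \<le> ?M k $ i $ j" "(?M k *v 1) $ i \<le> 1" for k i j
    unfolding inv_A_B_def
    by (rule regular_splitting_substochastic(1,2)[of "?A k" "?N k"];
        fact mono_A mono_W N_nonneg row_sum)+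
  have no_fixed: "u = 0" if "?M k *v u = u" for k u
    by (rule regular_splitting_substochastic(3)[of "?A k" "?N k"];
        fact mono_A mono_W N_nonneg row_sum that[unfolded inv_A_B_def])
  have step: "v (Suc k) = ?M k *v v k + ?q k" for k
  proof -
    obtain I \<delta> I' \<delta>' where \<phi>: "\<phi> k = (I, \<delta>)" "\<phi> (Suc k) = (I', \<delta>')" by (metis surj_pair)
    have sys: "?A k *v v (Suc k) = ?N k *v v k + coeff_C pt f c g (\<phi> k) (\<phi> (Suc k))"
      unfolding \<phi>
      by (rule iterate_linear_system[OF grid lam_pos])
        (use maximal[of "Suc k"] solves[of k] next_I[of k] \<phi> in auto)
    have "invertible (?A k)" using mono_A by (rule monotone_matrix_invertible)
    then have "v (Suc k) = matrix_inv (?A k) *v (?A k *v v (Suc k))"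
      by (simp add: matrix_vector_mul_assoc invertible_matrix_inv)
    then show ?thesis
      unfolding sys by (simp add: matrix_vector_right_distrib inv_A_B_def inv_A_C_def
          matrix_vector_mul_assoc)
  qed
  have fin: "finite (range (\<lambda>k. h (\<phi> k) (\<phi> (Suc k))))" for h :: "_ \<Rightarrow> _ \<Rightarrow> 'b"
  proof (rule finite_subset)
    show "range (\<lambda>k. h (\<phi> k) (\<phi> (Suc k))) \<subseteq> case_prod h ` (strategies pt Z \<times> strategies pt Z)"
      using strategy by force
  qed (simp add: finite_strategies Z_finite)
  obtain M where M: "\<forall>\<^sub>F k in sequentially. ?M k = M"
    using convergent_finite_range_eventually_constant[OF fin conv_B] .
  obtain q where q: "\<forall>\<^sub>F k in sequentially. ?q k = q"
    using convergent_finite_range_eventually_constant[OF fin conv_C] .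
  obtain K where K: "?M K = M"
    using M eventually_happens'[OF sequentially_bot] by blast
  show "convergent v"
  proof (rule substochastic_iteration_convergent)
    show "0 \<le> M $ i $ j" "(M *v 1) $ i \<le> 1" "M *v u = u \<Longrightarrow> u = 0" for i j u
      using substochastic[of K] no_fixed[of K] unfolding K by blast+
    show "\<forall>\<^sub>F k in sequentially. v (Suc k) = M *v v k + q"
      using M q by eventually_elim (simp add: step)
  qed
qed

end
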